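(* Let $K\in\mathbb N$ and let $G:[0,\infty)\to\mathbb R^{K\times K}$ be a decay kernel such that $\widetilde G$ is a positive definite matrix-valued function. Then for all $X_0\in\mathbb R^K$ and each time grid $\mathbb T=\{t_1,\dots,t_N\}$ there exists an optimal strategy in $\mathscr X_{\mathrm{det}}(\mathbb T,X_0)$ (and hence in $\mathscr X(\mathbb T,X_0)$). Moreover, a strategy $\boldsymbol\xi\in\mathscr X_{\mathrm{det}}(\mathbb T,X_0)$ is optimal if and only if there exists $\lambda\in\mathbb R^K$ such that $$\sum_{\ell=1}^N\widetilde G(t_k-t_\ell)\xi_\ell=\lambda\qquad\text{for }k=1,\dots,N.$$ If $\widetilde G$ is strictly positive definite, then optimal strategies and the Lagrange multiplier $\lambda$ in the preceding equation are unique.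
   Context: A decay kernel is a continuous function $G:[0,\infty)\to\mathbb R^{K\times K}$. Its extension $\widetilde G:\mathbb R\to\mathbb R^{K\times K}$ is $\widetilde G(t)=G(t)$ for $t>0$, $\widetilde G(0)=\frac12(G(0)^\top+G(0))$, $\widetilde G(t)=G(-t)^\top$ for $t<0$. A time grid is a finite set $\mathbb T=\{t_1,\dots,t_N\}$, $N\in\mathbb N$, with $0=t_1<t_2<\dots<t_N$. Let $(\Omega,\mathscr F,(\mathscr F_t)_{t\in[0,T]},\mathbb P)$ be a filtered probability space, with $\mathscr F_t=\mathscr F_T$ for $t>T$. $\mathscr X(\mathbb T,X_0)$ is the set of $\boldsymbol\xi=(\xi_1,\dots,\xi_N)$ such that each $\xi_k$ is a bounded $\mathscr F_{t_k}$-measurable $\mathbb R^K$-valued random variable and $X_0+\sum_{k=1}^N\xi_k=0$ $\mathbb P$-a.s.; $\mathscr X_{\mathrm{det}}(\mathbb T,X_0)$ is the subset of deterministic strategies (not depending on $\omega$). The cost function is $C_{\mathbb T}(\boldsymbol\xi)=\frac12\sum_{k,\ell=1}^N\xi_k^\top\widetilde G(t_k-t_\ell)\xi_\ell$. A strategy is optimal in $\mathscr X(\mathbb T,X_0)$ (resp. in $\mathscr X_{\mathrm{det}}(\mathbb T,X_0)$) if it minimizes $\mathbb E[C_{\mathbb T}(\cdot)]$ over that class (for deterministic strategies this is just $C_{\mathbb T}$). Strategies that agree $\mathbb P$-a.s. are identified. A function $H:\mathbb R\to\mathbb C^{K\times K}$ is a positive definite matrix-valued function if $\sum_{i,j=1}^N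 z_i^*H(t_i-t_j)z_j\ge0$ for all $N\in\mathbb N$, $t_1,\dots,t_N\in\mathbb R$, $z_1,\dots,z_N\in\mathbb C^K$ ($^*$ denotes conjugate transpose). It is strictly positive definite if, in addition, for pairwise distinct $t_1,\dots,t_N$ equality holds only when $z_1=\dots=z_N=0$. *)

theory Defs
  imports "HOL-Probability.Probability"
begin

section \<open>Decay kernels and positive definite matrix-valued functions\<close>

text \<open>Only the values of \<open>G\<close> on \<open>[0, \<infinity>)\<close> are meaningful.\<close>

definition decay_kernel :: "(real \<Rightarrow> real^'k^'k) \<Rightarrow> bool" where
  "decay_kernel G \<longleftrightarrow> continuous_on {0..} G"

definition kernel_ext :: "(real \<Rightarrow> real^'k^'k) \<Rightarrow> real \<Rightarrow> real^'k^'k" where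
  "kernel_ext G t =
     (if t > 0 then G t
      else if t = 0 then (1/2) *\<^sub>R (transpose (G 0) + G 0)
      else transpose (G (- t)))"

text \<open>The sesquilinear expression \<open>z\<^sup>* A w\<close>.\<close>

definition sesq :: "complex^'k \<Rightarrow> complex^'k^'k \<Rightarrow> complex^'k \<Rightarrow> complex" where
  "sesq z A w = (\<Sum>a\<in>UNIV. cnj (z $ a) * (A *v w) $ a)"

text \<open>Membership in \<^term>\<open>\<real>\<^sub>\<ge>\<^sub>0 :: complex set\<close> expresses \<open>\<ge> 0\<close> for a complex
  number, so that the sum is required to be real.\<close>

definition pos_def_fun :: "(real \<Rightarrow> complex^'k^'k) \<Rightarrow> bool" where
  "pos_def_fun H \<longleftrightarrow>
     (\<forall>(N::nat) (t :: nat \<Rightarrow> real) (z :: nat \<Rightarrow> complex^'k).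
        (\<Sum>i=1..N. \<Sum>j=1..N. sesq (z i) (H (t i - t j)) (z j)) \<in> \<real>\<^sub>\<ge>\<^sub>0)"

definition strictly_pos_def_fun :: "(real \<Rightarrow> complex^'k^'k) \<Rightarrow> bool" where
  "strictly_pos_def_fun H \<longleftrightarrow> pos_def_fun H \<and>
     (\<forall>(N::nat) (t :: nat \<Rightarrow> real) (z :: nat \<Rightarrow> complex^'k).
        inj_on t {1..N} \<longrightarrow>
        (\<Sum>i=1..N. \<Sum>j=1..N. sesq (z i) (H (t i - t j)) (z j)) = 0 \<longrightarrow>
        (\<forall>i\<in>{1..N}. z i = 0))"

definition complexify :: "(real \<Rightarrow> real^'k^'k) \<Rightarrow> real \<Rightarrow> complex^'k^'k" where
  "complexify H t = map_matrix complex_of_real (H t)"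


section \<open>Strategies and their cost\<close>

text \<open>The grid \<open>{t\<^sub>1, \<dots>, t\<^sub>N}\<close> is given by its length and its increasing enumeration on
  \<open>{1..N}\<close>; values of \<open>t\<close> (and of strategies) at other indices are irrelevant.\<close>

definition time_grid :: "nat \<Rightarrow> (nat \<Rightarrow> real) \<Rightarrow> bool" where
  "time_grid N t \<longleftrightarrow> 1 \<le> N \<and> t 1 = 0 \<and> strict_mono_on {1..N} t"

text \<open>A filtration indexed by \<open>[0, T]\<close> and continued by \<open>F T\<close> after \<open>T\<close>. Only the
  sigma-algebras of the measures \<open>F t\<close>, \<open>t \<ge> 0\<close>, matter. The library locale
  \<^const>\<open>filtration\<close> would also constrain negative times.\<close>

locale filtered_prob_space = prob_space M for M :: "'w measure" +
  fixes F :: "real \<Rightarrow> 'w measure" and T :: real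
  assumes horizon_nonneg: "0 \<le> T"
    and subalg: "\<And>t. 0 \<le> t \<Longrightarrow> t \<le> T \<Longrightarrow> subalgebra M (F t)"
    and filtration_mono: "\<And>s t. 0 \<le> s \<Longrightarrow> s \<le> t \<Longrightarrow> t \<le> T \<Longrightarrow> subalgebra (F t) (F s)"
    and after_horizon: "\<And>t. T < t \<Longrightarrow> sets (F t) = sets (F T)"

definition strategies ::
  "'w measure \<Rightarrow> (real \<Rightarrow> 'w measure) \<Rightarrow> nat \<Rightarrow> (nat \<Rightarrow> real) \<Rightarrow> real^'k \<Rightarrow>
   (nat \<Rightarrow> 'w \<Rightarrow> real^'k) set" where
  "strategies M F N t X0 =
     {\<xi>. (\<forall>k\<in>{1..N}. \<xi> k \<in> borel_measurable (F (t k)) \<and> bounded (\<xi> k ` space M)) \<and>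
         (AE \<omega> in M. X0 + (\<Sum>k=1..N. \<xi> k \<omega>) = 0)}"

definition det_strategies ::
  "'w measure \<Rightarrow> (real \<Rightarrow> 'w measure) \<Rightarrow> nat \<Rightarrow> (nat \<Rightarrow> real) \<Rightarrow> real^'k \<Rightarrow>
   (nat \<Rightarrow> 'w \<Rightarrow> real^'k) set" where
  "det_strategies M F N t X0 =
     {\<xi> \<in> strategies M F N t X0. \<forall>k\<in>{1..N}. \<xi> k constant_on space M}"

definition cost ::
  "(real \<Rightarrow> real^'k^'k) \<Rightarrow> nat \<Rightarrow> (nat \<Rightarrow> real) \<Rightarrow> (nat \<Rightarrow> real^'k) \<Rightarrow> real" where
  "cost G N t x =
     1/2 * (\<Sum>k=1..N. \<Sum>l=1..N. x k \<bullet> (kernel_ext G (t k - t l) *v x l))"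

text \<open>The integrand below is bounded and measurable for every strategy, so the
  convention that a Bochner integral of a non-integrable function is \<open>0\<close> plays no role.\<close>

definition expected_cost ::
  "'w measure \<Rightarrow> (real \<Rightarrow> real^'k^'k) \<Rightarrow> nat \<Rightarrow> (nat \<Rightarrow> real) \<Rightarrow>
   (nat \<Rightarrow> 'w \<Rightarrow> real^'k) \<Rightarrow> real" where
  "expected_cost M G N t \<xi> = (\<integral>\<omega>. cost G N t (\<lambda>k. \<xi> k \<omega>) \<partial>M)"

definition optimal_in ::
  "(nat \<Rightarrow> 'w \<Rightarrow> real^'k) set \<Rightarrow> 'w measure \<Rightarrow> (real \<Rightarrow> real^'k^'k) \<Rightarrow> nat \<Rightarrow>
   (nat \<Rightarrow> real) \<Rightarrow> (nat \<Rightarrow> 'w \<Rightarrow> real^'k) \<Rightarrow> bool" where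
  "optimal_in S M G N t \<xi> \<longleftrightarrow>
     \<xi> \<in> S \<and> (\<forall>\<eta>\<in>S. expected_cost M G N t \<xi> \<le> expected_cost M G N t \<eta>)"

definition same_strategy ::
  "'w measure \<Rightarrow> nat \<Rightarrow> (nat \<Rightarrow> 'w \<Rightarrow> real^'k) \<Rightarrow> (nat \<Rightarrow> 'w \<Rightarrow> real^'k) \<Rightarrow> bool" where
  "same_strategy M N \<xi> \<eta> \<longleftrightarrow> (AE \<omega> in M. \<forall>k\<in>{1..N}. \<xi> k \<omega> = \<eta> k \<omega>)"

definition lagrange_eq ::
  "'w measure \<Rightarrow> (real \<Rightarrow> real^'k^'k) \<Rightarrow> nat \<Rightarrow> (nat \<Rightarrow> real) \<Rightarrow>
   (nat \<Rightarrow> 'w \<Rightarrow> real^'k) \<Rightarrow> real^'k \<Rightarrow> bool" where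
  "lagrange_eq M G N t \<xi> lam \<longleftrightarrow>
     (\<forall>\<omega>\<in>space M. \<forall>k\<in>{1..N}. (\<Sum>l=1..N. kernel_ext G (t k - t l) *v \<xi> l \<omega>) = lam)"

end

theory Submission
  imports Defs "HOL-Library.Function_Algebras"
begin

text \<open>
  On the real vector space of finite families in \<open>\<real>\<^sup>K\<close> the cost is half the quadratic form
  of a symmetric positive semidefinite bilinear form \<open>B\<close>, and a feasible \<open>x\<close> solves the
  Lagrange equations iff \<open>B x v = 0\<close> for all directions \<open>v\<close> summing to zero. Such an \<open>x\<close> is
  obtained from any feasible point by subtracting its \<open>B\<close>-orthogonal projection to the finitely
  generated space of directions; Gram-Schmidt works although \<open>B\<close> may be degenerate, because
  null vectors of \<open>B\<close> are orthogonal to everything. Then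
  \<open>B y y = B x x + B (y - x) (y - x)\<close> for every feasible \<open>y\<close>. Read pointwise in \<open>\<omega>\<close> and
  integrated, this identity shows optimality of \<open>x\<close> also among adapted strategies, and
  uniqueness when \<open>B\<close> is definite.
\<close>

section \<open>Symmetric positive semidefinite bilinear forms\<close>

text \<open>Scaling is a parameter so that the locale applies to families
  \<open>nat \<Rightarrow> real^'k\<close> with pointwise \<open>fscale\<close>. Degenerate forms
  are allowed: \<open>kernel_form\<close> does not see entries outside
  \<open>{1..N}\<close>.\<close>

locale psd_form = vector_space scale
  for scale :: "real \<Rightarrow> 'v::ab_group_add \<Rightarrow> 'v" +
  fixes B :: "'v \<Rightarrow> 'v \<Rightarrow> real"
  assumes add_left: "B (x + y) z = B x z + B y z"
    and scale_left: "B (scale c x) z = c * B x z"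
    and sym: "B x y = B y x"
    and nonneg: "0 \<le> B x x"
begin

lemma add_right: "B z (x + y) = B z x + B z y"
  by (metis add_left sym)

lemma scale_right: "B z (scale c x) = c * B z x"
  by (metis scale_left sym)

lemma zero_right [simp]: "B z 0 = 0"
  using add_right[of z 0 0] by simp

lemma diff_left: "B (x - y) z = B x z - B y z"
  using add_left[of "x - y" y z] by simp

lemma diff_right: "B z (x - y) = B z x - B z y"
  by (metis diff_left sym)

lemmas bilinear = add_left add_right diff_left diff_right scale_left scale_right

lemma expand_around: "B y y = B x x + 2 * B x (y - x) + B (y - x) (y - x)"
  by (simp add: bilinear sym[of y x])

lemma stationary:
  assumes "\<And>r. B x x \<le> B (x + scale r s) (x + scale r s)"
  shows "B x s = 0"
proof -
  define b q where "b = B x s" and "q = B s s"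
  have q: "q \<ge> 0" by (simp add: q_def nonneg)
  \<comment> \<open>A step of size \<open>r\<close> changes the form by
    \<open>2 * r * b + r * r * q\<close>, which is \<open>- (r * r * (q + 2))\<close> for this
    \<open>r\<close>. The summand 1 keeps the denominator positive when
    \<open>q = 0\<close>.\<close>
  define r where "r = - b / (q + 1)"
  have rq: "r * (q + 1) = - b" using q by (simp add: r_def)
  have "B (x + scale r s) (x + scale r s) = B x x + 2 * r * b + r * r * q"
    by (simp add: bilinear sym[of s x] b_def q_def algebra_simps)
  with assms[of r] have "0 \<le> 2 * r * b + r * r * q" by simp
  also have "\<dots> = - (r * r * (q + 2))"
    using rq by algebra
  finally have "r * r * (q + 2) \<le> 0" by simp
  moreover have "r * r * (q + 2) \<ge> 0" using q by simp
  ultimately have "r * r * (q + 2) = 0" by simp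
  hence "r = 0" using q by simp
  thus ?thesis using rq by (simp add: b_def)
qed

text \<open>A null vector minimises the form along every line through it, since all values are
  nonnegative.\<close>

lemma null_vector_orthogonal: "B x x = 0 \<Longrightarrow> B x y = 0"
  by (rule stationary) (simp add: nonneg)

lemma orthogonal_span:
  assumes "\<And>s. s \<in> S \<Longrightarrow> B x s = 0" and "v \<in> span S"
  shows "B x v = 0"
  using assms(2) by (induction rule: span_induct_alt) (auto simp: bilinear assms(1))

lemma projection_exists:
  assumes "finite S"
  shows "\<exists>u\<in>span S. \<forall>s\<in>S. B (x - u) s = 0"
  using assms
proof (induction S arbitrary: x)
  case empty
  show ?case by (auto simp: span_zero)
next
  case (insert s S)
  \<comment> \<open>The induction hypothesis is used for two vectors: it makes the new generator
    \<open>s\<close> orthogonal to \<open>S\<close>, and it projects \<open>x\<close>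
    itself.\<close>
  obtain w where w: "w \<in> span S" "\<And>s'. s' \<in> S \<Longrightarrow> B (s - w) s' = 0"
    using insert.IH by blast
  obtain u where u: "u \<in> span S" "\<And>s'. s' \<in> S \<Longrightarrow> B (x - u) s' = 0"
    using insert.IH by blast
  define p where "p = s - w"
  \<comment> \<open>If \<open>p\<close> is a null vector, division by zero gives \<open>c = 0\<close>, which is a correct choice.\<close>
  define c where "c = B (x - u) p / B p p"
  have c: "c * B p p = B (x - u) p"
    using null_vector_orthogonal[of p "x - u"] by (auto simp: c_def sym)
  have pS: "B p s' = 0" if "s' \<in> S" for s'
    using w(2) that by (simp add: p_def)
  have pw: "B p w = 0" and uw: "B (x - u) w = 0"
    using orthogonal_span[of S] w u pS by auto
  have sub: "span S \<subseteq> span (insert s S)"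
    by (intro span_mono) auto
  have "p \<in> span (insert s S)"
    unfolding p_def using w(1) sub by (intro span_diff) (auto intro: span_base)
  hence 1: "u + scale c p \<in> span (insert s S)"
    using u(1) sub by (intro span_add span_scale) auto
  \<comment> \<open>In \<open>s = p + w\<close>, the choice of \<open>c\<close> settles
    \<open>p\<close>, and \<open>w\<close> lies in \<open>span S\<close>, to which both
    \<open>x - u\<close> and \<open>p\<close> are orthogonal.\<close>
  have "B (x - (u + scale c p)) s = B (x - (u + scale c p)) (p + w)"
    by (simp add: p_def)
  also have "\<dots> = 0"
    using c pw uw by (simp add: bilinear)
  finally have 2: "B (x - (u + scale c p)) s = 0" .
  have 3: "B (x - (u + scale c p)) s' = 0" if "s' \<in> S" for s'
    using pS[OF that] u(2)[OF that] by (simp add: bilinear)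
  show ?case using 1 2 3 by blast
qed

end

section \<open>The bilinear form of a decay kernel\<close>

abbreviation fscale :: "real \<Rightarrow> (nat \<Rightarrow> real^'k) \<Rightarrow> nat \<Rightarrow> real^'k" where
  "fscale c x \<equiv> \<lambda>k. c *\<^sub>R x k"

definition kernel_form ::
  "(real \<Rightarrow> real^'k^'k) \<Rightarrow> nat \<Rightarrow> (nat \<Rightarrow> real) \<Rightarrow> (nat \<Rightarrow> real^'k) \<Rightarrow> (nat \<Rightarrow> real^'k) \<Rightarrow> real" where
  "kernel_form G N t x y = (\<Sum>k=1..N. \<Sum>l=1..N. x k \<bullet> (kernel_ext G (t k - t l) *v y l))"

text \<open>The left-hand side of the Lagrange equation at index \<open>k\<close>. As the form is
  symmetric, this is the gradient of the cost in the \<open>k\<close>-th trade.\<close>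

definition kernel_apply ::
  "(real \<Rightarrow> real^'k^'k) \<Rightarrow> nat \<Rightarrow> (nat \<Rightarrow> real) \<Rightarrow> (nat \<Rightarrow> real^'k) \<Rightarrow> nat \<Rightarrow> real^'k" where
  "kernel_apply G N t x k = (\<Sum>l=1..N. kernel_ext G (t k - t l) *v x l)"

lemma cost_eq_kernel_form: "cost G N t x = kernel_form G N t x x / 2"
  by (simp add: cost_def kernel_form_def)

lemma kernel_form_eq_apply: "kernel_form G N t x y = (\<Sum>k=1..N. x k \<bullet> kernel_apply G N t y k)"
  by (simp add: kernel_form_def kernel_apply_def inner_sum_right)

lemma cost_cong: "(\<And>k. k \<in> {1..N} \<Longrightarrow> x k = y k) \<Longrightarrow> cost G N t x = cost G N t y"
  unfolding cost_def by (intro arg_cong2[where f="(*)"] refl sum.cong) auto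

lemma transpose_scaleR: "transpose (c *\<^sub>R A) = c *\<^sub>R transpose (A :: real^'n^'m)"
  by (simp add: transpose_def vec_eq_iff)

lemma transpose_add: "transpose (A + C) = transpose A + transpose (C :: real^'n^'m)"
  by (simp add: transpose_def vec_eq_iff)

text \<open>Negation exchanges the branches for positive and negative arguments; at 0 the
  symmetrised value is its own transpose.\<close>

lemma kernel_ext_minus: "kernel_ext G (- s) = transpose (kernel_ext G s)"
  by (auto simp: kernel_ext_def transpose_scaleR transpose_add add.commute)

lemma kernel_form_sym: "kernel_form G N t x y = kernel_form G N t y x"
proof -
  have "x k \<bullet> (kernel_ext G (t k - t l) *v y l) = y l \<bullet> (kernel_ext G (t l - t k) *v x k)" for k l
    using kernel_ext_minus[of G "t k - t l"]
    by (simp add: dot_lmul_matrix[symmetric] inner_commute)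
  thus ?thesis
    unfolding kernel_form_def by (subst sum.swap) simp
qed

text \<open>Places real families among the complex test vectors of \<open>pos_def_fun\<close>, which
  turns the complex hypotheses into statements about the real \<open>kernel_form\<close>.\<close>

definition complex_vec :: "real^'k \<Rightarrow> complex^'k" where
  "complex_vec x = (\<chi> i. complex_of_real (x $ i))"

lemma complex_vec_eq_0_iff: "complex_vec x = 0 \<longleftrightarrow> x = 0"
  by (simp add: complex_vec_def vec_eq_iff)

lemma sesq_complexify:
  "sesq (complex_vec x) (complexify H s) (complex_vec y) = complex_of_real (x \<bullet> (H s *v y))"
  by (simp add: sesq_def complexify_def complex_vec_def inner_vec_def matrix_vector_mult_def
      map_matrix_def)

lemma sum_sesq_complexify:
  "(\<Sum>i=1..N. \<Sum>j=1..N. sesq (complex_vec (x i)) (complexify (kernel_ext G) (t i - t j))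
      (complex_vec (x j))) = complex_of_real (kernel_form G N t x x)"
  by (simp add: sesq_complexify kernel_form_def)

lemma kernel_form_nonneg:
  assumes "pos_def_fun (complexify (kernel_ext G))"
  shows "0 \<le> kernel_form G N t x x"
proof -
  have "complex_of_real (kernel_form G N t x x) \<in> \<real>\<^sub>\<ge>\<^sub>0"
    using assms[unfolded pos_def_fun_def, rule_format, of "\<lambda>i. complex_vec (x i)" t N]
    by (simp only: sum_sesq_complexify)
  thus ?thesis by simp
qed

lemma kernel_form_definite:
  assumes "strictly_pos_def_fun (complexify (kernel_ext G))" and "inj_on t {1..N}"
    and "kernel_form G N t x x = 0" and "k \<in> {1..N}"
  shows "x k = 0"
proof -
  have "(\<Sum>i=1..N. \<Sum>j=1..N. sesq (complex_vec (x i)) (complexify (kernel_ext G) (t i - t j))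
      (complex_vec (x j))) = 0"
    using assms(3) by (simp only: sum_sesq_complexify) simp
  with assms(1)[unfolded strictly_pos_def_fun_def, THEN conjunct2, THEN spec[of _ N],
      THEN spec[of _ t], THEN spec[of _ "\<lambda>i. complex_vec (x i)"]] assms(2,4)
  have "complex_vec (x k) = 0" by blast
  thus ?thesis by (simp add: complex_vec_eq_0_iff)
qed

lemma psd_form_kernel:
  assumes "pos_def_fun (complexify (kernel_ext G))"
  shows "psd_form fscale (kernel_form G N t)"
proof unfold_locales
  show "kernel_form G N t x y = kernel_form G N t y x" for x y
    by (rule kernel_form_sym)
  show "0 \<le> kernel_form G N t x x" for x
    by (rule kernel_form_nonneg[OF assms])
  show "kernel_form G N t (x + y) z = kernel_form G N t x z + kernel_form G N t y z" for x y z
    by (simp add: kernel_form_eq_apply inner_add_left sum.distrib)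
  show "kernel_form G N t (fscale c x) z = c * kernel_form G N t x z" for c x z
    by (simp add: kernel_form_eq_apply sum_distrib_left)
qed (simp_all add: fun_eq_iff scaleR_add_left scaleR_add_right)

section \<open>Deterministic minimisers\<close>

definition feasible :: "nat \<Rightarrow> real^'k \<Rightarrow> (nat \<Rightarrow> real^'k) \<Rightarrow> bool" where
  "feasible N X0 x \<longleftrightarrow> X0 + (\<Sum>k=1..N. x k) = 0"

text \<open>The counterpart of \<open>lagrange_eq\<close> for a fixed family without
  \<open>\<omega>\<close>; \<open>lagrange_eq_iff\<close> connects the two.\<close>

definition stationary_point ::
  "(real \<Rightarrow> real^'k^'k) \<Rightarrow> nat \<Rightarrow> (nat \<Rightarrow> real) \<Rightarrow> (nat \<Rightarrow> real^'k) \<Rightarrow> real^'k \<Rightarrow> bool" where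
  "stationary_point G N t x lam \<longleftrightarrow> (\<forall>k\<in>{1..N}. kernel_apply G N t x k = lam)"

text \<open>Moves the amount \<open>e\<close> from trade 1 to trade \<open>k\<close>. Writing it as
  a difference of two indicators makes it zero for \<open>k = 1\<close>.\<close>

definition transfer_dir :: "nat \<Rightarrow> real^'k \<Rightarrow> nat \<Rightarrow> real^'k" where
  "transfer_dir k e = (\<lambda>i. (if i = k then e else 0) - (if i = 1 then e else 0))"

lemma sum_transfer_dir:
  assumes "k \<in> {1..N}"
  shows "(\<Sum>i=1..N. transfer_dir k e i) = 0"
  using assms by (simp add: transfer_dir_def sum_subtractf)

lemma kernel_form_transfer_dir:
  assumes "k \<in> {1..N}"
  shows "kernel_form G N t (transfer_dir k e) x
       = e \<bullet> (kernel_apply G N t x k - kernel_apply G N t x 1)"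
proof -
  have "kernel_form G N t (transfer_dir k e) x =
    (\<Sum>i=1..N. (if i = k then e \<bullet> kernel_apply G N t x i else 0) -
               (if i = 1 then e \<bullet> kernel_apply G N t x i else 0))"
    unfolding kernel_form_eq_apply
    by (intro sum.cong) (auto simp: transfer_dir_def inner_diff_left)
  also have "\<dots> = e \<bullet> (kernel_apply G N t x k - kernel_apply G N t x 1)"
    using assms by (simp add: sum_subtractf inner_diff_right)
  finally show ?thesis .
qed

text \<open>Orthogonality to \<open>transfer_dir k e\<close> says that the values of
  \<open>kernel_apply\<close> at \<open>k\<close> and at 1 have the same \<open>e\<close>-component.
  With \<open>e\<close> running through the basis the values agree, and the one at index 1 is the
  multiplier.\<close>

lemma stationary_pointI:
  assumes "\<And>k e. k \<in> {1..N} \<Longrightarrow> e \<in> Basis \<Longrightarrow> kernel_form G N t x (transfer_dir k e) = 0"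
  shows "stationary_point G N t x (kernel_apply G N t x 1)"
  unfolding stationary_point_def
proof
  fix k assume k: "k \<in> {1..N}"
  have "e \<bullet> (kernel_apply G N t x k - kernel_apply G N t x 1) = 0" if "e \<in> Basis" for e
    using assms[OF k that] kernel_form_transfer_dir[OF k, of G t e x]
      kernel_form_sym[of G N t x "transfer_dir k e"] by metis
  hence "kernel_apply G N t x k - kernel_apply G N t x 1 = 0"
    using euclidean_all_zero_iff by (metis inner_commute)
  thus "kernel_apply G N t x k = kernel_apply G N t x 1" by simp
qed

lemma stationary_point_exists:
  fixes G :: "real \<Rightarrow> real^'k^'k"
  assumes "pos_def_fun (complexify (kernel_ext G))" and "1 \<le> N"
  shows "\<exists>x lam. feasible N X0 x \<and> stationary_point G N t x lam"
proof -
  interpret psd_form fscale "kernel_form G N t" by (rule psd_form_kernel[OF assms(1)])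
  define S where "S = (\<lambda>(k, e). transfer_dir k e) ` ({1..N} \<times> (Basis :: (real^'k) set))"
  \<comment> \<open>The feasible starting point liquidates everything in the first trade, which
    exists because \<open>1 \<le> N\<close>.\<close>
  define x0 :: "nat \<Rightarrow> real^'k" where "x0 = (\<lambda>i. if i = 1 then - X0 else 0)"
  have "finite S" by (simp add: S_def)
  then obtain u where u: "u \<in> span S" "\<And>s. s \<in> S \<Longrightarrow> kernel_form G N t (x0 - u) s = 0"
    using projection_exists by blast
  \<comment> \<open>All of \<open>span S\<close> sums to zero, so subtracting the projection
    \<open>u\<close> keeps \<open>x0\<close> feasible.\<close>
  have "subspace {v :: nat \<Rightarrow> real^'k. (\<Sum>i=1..N. v i) = 0}"
    by (auto simp: subspace_def sum.distrib simp flip: scaleR_sum_right)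
  moreover have "S \<subseteq> {v. (\<Sum>i=1..N. v i) = 0}"
    by (auto simp: S_def sum_transfer_dir[unfolded One_nat_def])
  ultimately have "(\<Sum>i=1..N. u i) = 0"
    using u(1) span_minimal by blast
  hence "feasible N X0 (x0 - u)"
    using assms(2) by (simp add: feasible_def x0_def sum_subtractf)
  moreover have "stationary_point G N t (x0 - u) (kernel_apply G N t (x0 - u) 1)"
    by (rule stationary_pointI) (force intro!: u(2) simp: S_def)
  ultimately show ?thesis by blast
qed

text \<open>Pythagoras: the cross term in \<open>expand_around\<close> is \<open>lam\<close> paired
  with the total of \<open>y - x\<close>, and this total vanishes because both families meet the
  same constraint.\<close>

lemma cost_around_stationary_point:
  assumes "pos_def_fun (complexify (kernel_ext G))"
    and "feasible N X0 x" "stationary_point G N t x lam" "feasible N X0 y"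
  shows "cost G N t y = cost G N t x + cost G N t (y - x)"
proof -
  interpret psd_form fscale "kernel_form G N t" by (rule psd_form_kernel[OF assms(1)])
  have "kernel_form G N t (y - x) x = (\<Sum>k=1..N. (y - x) k \<bullet> lam)"
    unfolding kernel_form_eq_apply using assms(3) by (simp add: stationary_point_def)
  also have "\<dots> = ((X0 + (\<Sum>k=1..N. y k)) - (X0 + (\<Sum>k=1..N. x k))) \<bullet> lam"
    by (simp add: sum_subtractf flip: inner_sum_left)
  also have "\<dots> = 0" using assms(2,4) by (simp add: feasible_def)
  finally show ?thesis
    using expand_around[of y x] by (simp add: cost_eq_kernel_form sym)
qed

lemma cost_nonneg:
  "pos_def_fun (complexify (kernel_ext G)) \<Longrightarrow> 0 \<le> cost G N t x"
  by (simp add: cost_eq_kernel_form kernel_form_nonneg)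

text \<open>First-order condition: every multiple of a transfer direction preserves feasibility, so
  minimality applies along the whole line and \<open>stationary\<close> gives orthogonality.\<close>

lemma minimiser_stationary_point:
  assumes "pos_def_fun (complexify (kernel_ext G))"
    and "feasible N X0 x" "\<And>y. feasible N X0 y \<Longrightarrow> cost G N t x \<le> cost G N t y"
  shows "stationary_point G N t x (kernel_apply G N t x 1)"
proof (rule stationary_pointI)
  interpret psd_form fscale "kernel_form G N t" by (rule psd_form_kernel[OF assms(1)])
  fix k e assume k: "k \<in> {1..N}"
  show "kernel_form G N t x (transfer_dir k e) = 0"
  proof (rule stationary)
    fix r
    have "feasible N X0 (x + fscale r (transfer_dir k e))"
      using assms(2) sum_transfer_dir[OF k, of e]
      by (simp add: feasible_def sum.distrib flip: scaleR_sum_right)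
    from assms(3)[OF this]
    show "kernel_form G N t x x \<le> kernel_form G N t (x + fscale r (transfer_dir k e))
            (x + fscale r (transfer_dir k e))"
      by (simp add: cost_eq_kernel_form)
  qed
qed

section \<open>Adapted strategies\<close>

text \<open>On an empty space \<open>lagrange_eq\<close> would hold vacuously for every
  \<open>lam\<close>, hence the first assumption.\<close>

lemma lagrange_eq_iff:
  assumes "space M \<noteq> {}" and "\<And>\<omega> k. \<omega> \<in> space M \<Longrightarrow> k \<in> {1..N} \<Longrightarrow> \<xi> k \<omega> = x k"
  shows "lagrange_eq M G N t \<xi> lam \<longleftrightarrow> stationary_point G N t x lam"
proof -
  have "(\<Sum>l=1..N. kernel_ext G (t k - t l) *v \<xi> l \<omega>) = kernel_apply G N t x k"
    if "\<omega> \<in> space M" for k \<omega>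
    unfolding kernel_apply_def using assms(2)[OF that] by (intro sum.cong) auto
  thus ?thesis
    using assms(1) by (auto simp: lagrange_eq_def stationary_point_def)
qed

section \<open>Measurability and integrability of strategies\<close>

context filtered_prob_space
begin

text \<open>After the horizon \<open>F s\<close> is known only to have the same measurable sets as
  \<open>F T\<close>, so measurability is first moved to \<open>F T\<close>.\<close>

lemma measurable_filtrationD:
  assumes "0 \<le> s" and "f \<in> borel_measurable (F s)"
  shows "f \<in> borel_measurable M"
proof (cases "s \<le> T")
  case True
  thus ?thesis using assms subalg measurable_from_subalg by blast
next
  case False
  hence "sets (F s) = sets (F T)" using after_horizon by simp
  with assms(2) have "f \<in> borel_measurable (F T)"
    using measurable_cong_sets by blast
  thus ?thesis using subalg[OF horizon_nonneg] measurable_from_subalg by blast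
qed

lemma time_grid_nonneg:
  assumes "time_grid N t" "k \<in> {1..N}"
  shows "0 \<le> t k"
  using assms strict_mono_on_leD[of "{1..N}" t 1 k] unfolding time_grid_def by simp

lemma strategies_measurable:
  assumes "time_grid N t" "\<xi> \<in> strategies M F N t X0" "k \<in> {1..N}"
  shows "\<xi> k \<in> borel_measurable M"
proof (rule measurable_filtrationD)
  show "0 \<le> t k" using assms(1,3) by (rule time_grid_nonneg)
  show "\<xi> k \<in> borel_measurable (F (t k))" using assms(2,3) unfolding strategies_def by blast
qed

lemma strategies_AE_feasible:
  "\<xi> \<in> strategies M F N t X0 \<Longrightarrow> AE \<omega> in M. feasible N X0 (\<lambda>k. \<xi> k \<omega>)"
  by (simp add: strategies_def feasible_def)

lemma det_subset_strategies: "det_strategies M F N t X0 \<subseteq> strategies M F N t X0"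
  by (auto simp: det_strategies_def)

lemma integrable_inner_matrix_vector:
  fixes f :: "'w \<Rightarrow> real^'m" and g :: "'w \<Rightarrow> real^'n" and A :: "real^'n^'m"
  assumes "f \<in> borel_measurable M" "g \<in> borel_measurable M"
    and "bounded (f ` space M)" "bounded (g ` space M)"
  shows "integrable M (\<lambda>\<omega>. f \<omega> \<bullet> (A *v g \<omega>))"
proof -
  have "bounded_linear ((*v) A)" by simp
  hence "continuous_on UNIV ((*v) A)" by (rule linear_continuous_on)
  hence "(*v) A \<in> borel_measurable borel" by (rule borel_measurable_continuous_onI)
  hence m: "(\<lambda>\<omega>. A *v g \<omega>) \<in> borel_measurable M"
    using assms(2) by measurable
  obtain a where a: "\<And>\<omega>. \<omega> \<in> space M \<Longrightarrow> norm (f \<omega>) \<le> a"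
    using assms(3) by (auto simp: bounded_iff)
  have "bounded ((*v) A ` g ` space M)"
    using assms(4) \<open>bounded_linear ((*v) A)\<close> by (rule bounded_linear_image)
  then obtain b where b: "\<And>\<omega>. \<omega> \<in> space M \<Longrightarrow> norm (A *v g \<omega>) \<le> b"
    by (auto simp: bounded_iff)
  show ?thesis
  proof (rule integrable_const_bound)
    show "AE \<omega> in M. norm (f \<omega> \<bullet> (A *v g \<omega>)) \<le> a * b"
    proof (rule AE_I2)
      fix \<omega> assume \<omega>: "\<omega> \<in> space M"
      have "norm (f \<omega> \<bullet> (A *v g \<omega>)) \<le> norm (f \<omega>) * norm (A *v g \<omega>)"
        by (simp add: Cauchy_Schwarz_ineq2)
      \<comment> \<open>Monotonicity of the product needs \<open>0 \<le> a\<close>, which follows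
        from the bound at this \<open>\<omega>\<close>.\<close>
      also have "\<dots> \<le> a * b"
        using a[OF \<omega>] b[OF \<omega>] norm_ge_zero[of "f \<omega>"]
          by (intro mult_mono norm_ge_zero) linarith+
      finally show "norm (f \<omega> \<bullet> (A *v g \<omega>)) \<le> a * b" .
    qed
    show "(\<lambda>\<omega>. f \<omega> \<bullet> (A *v g \<omega>)) \<in> borel_measurable M"
      using assms(1) m by measurable
  qed
qed

text \<open>The shift \<open>x\<close> lets one lemma cover both the cost of \<open>\<xi>\<close>
  itself (\<open>x = 0\<close>) and the remainder around a stationary point.\<close>

lemma integrable_cost_diff:
  assumes "time_grid N t" "\<xi> \<in> strategies M F N t X0"
  shows "integrable M (\<lambda>\<omega>. cost G N t ((\<lambda>k. \<xi> k \<omega>) - x))"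
proof -
  have "(\<lambda>\<omega>. \<xi> k \<omega> - x k) \<in> borel_measurable M"
    and "bounded ((\<lambda>\<omega>. \<xi> k \<omega> - x k) ` space M)" if "k \<in> {1..N}" for k
  proof -
    show "(\<lambda>\<omega>. \<xi> k \<omega> - x k) \<in> borel_measurable M"
      using strategies_measurable[OF assms that] by measurable
    show "bounded ((\<lambda>\<omega>. \<xi> k \<omega> - x k) ` space M)"
      using bounded_translation_minus[of "\<xi> k ` space M" "x k"] assms(2) that
      by (simp add: strategies_def image_image)
  qed
  thus ?thesis
    unfolding cost_def fun_diff_def
    by (intro integrable_mult_right Bochner_Integration.integrable_sum
        integrable_inner_matrix_vector) auto
qed

section \<open>Deterministic strategies as fixed families\<close>

lemma det_strategiesE:
  fixes X0 :: "real^'k"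
  assumes "\<xi> \<in> det_strategies M F N t X0"
  obtains x where "feasible N X0 x" "\<And>\<omega> k. \<omega> \<in> space M \<Longrightarrow> k \<in> {1..N} \<Longrightarrow> \<xi> k \<omega> = x k"
proof -
  have "\<forall>k\<in>{1..N}. \<exists>c. \<forall>\<omega>\<in>space M. \<xi> k \<omega> = c"
    using assms by (simp add: det_strategies_def constant_on_def)
  from bchoice[OF this]
  obtain x where x: "\<And>\<omega> k. \<omega> \<in> space M \<Longrightarrow> k \<in> {1..N} \<Longrightarrow> \<xi> k \<omega> = x k"
    by blast
  have "AE \<omega> in M. feasible N X0 (\<lambda>k. \<xi> k \<omega>)"
    using assms det_subset_strategies strategies_AE_feasible by blast
  hence "AE \<omega> in M. feasible N X0 x"
    using AE_space
  proof eventually_elim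
    case (elim \<omega>)
    have "(\<Sum>k=1..N. \<xi> k \<omega>) = (\<Sum>k=1..N. x k)"
      using x[OF elim(2)] by (intro sum.cong) auto
    with elim(1) show ?case by (simp add: feasible_def)
  qed
  \<comment> \<open>An almost sure statement that does not depend on \<open>\<omega>\<close> is true
    outright in a probability space.\<close>
  hence "feasible N X0 x" by simp
  with x show ?thesis using that by blast
qed

lemma const_det_strategy:
  "feasible N X0 x \<Longrightarrow> (\<lambda>k \<omega>. x k) \<in> det_strategies M F N t X0"
  by (simp add: det_strategies_def strategies_def feasible_def constant_on_def image_constant_conv)

lemma expected_cost_det:
  assumes "\<And>\<omega> k. \<omega> \<in> space M \<Longrightarrow> k \<in> {1..N} \<Longrightarrow> \<xi> k \<omega> = x k"
  shows "expected_cost M G N t \<xi> = cost G N t x"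
proof -
  have "expected_cost M G N t \<xi> = (\<integral>\<omega>. cost G N t x \<partial>M)"
    unfolding expected_cost_def
    by (intro Bochner_Integration.integral_cong refl cost_cong) (use assms in auto)
  thus ?thesis by (simp add: prob_space)
qed

section \<open>Optimality and uniqueness\<close>

lemma expected_cost_around_stationary_point:
  assumes "pos_def_fun (complexify (kernel_ext G))" and "time_grid N t"
    and "feasible N X0 x" "stationary_point G N t x lam" and "\<xi> \<in> strategies M F N t X0"
  shows "expected_cost M G N t \<xi> =
    cost G N t x + (\<integral>\<omega>. cost G N t ((\<lambda>k. \<xi> k \<omega>) - x) \<partial>M)"
proof -
  have int: "integrable M (\<lambda>\<omega>. cost G N t ((\<lambda>k. \<xi> k \<omega>) - x))" for x
    by (rule integrable_cost_diff[OF assms(2,5)])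
  have "expected_cost M G N t \<xi> = (\<integral>\<omega>. cost G N t x + cost G N t ((\<lambda>k. \<xi> k \<omega>) - x) \<partial>M)"
    unfolding expected_cost_def
  proof (rule integral_cong_AE)
    show "(\<lambda>\<omega>. cost G N t (\<lambda>k. \<xi> k \<omega>)) \<in> borel_measurable M"
      using int[of 0, THEN borel_measurable_integrable] by simp
    show "(\<lambda>\<omega>. cost G N t x + cost G N t ((\<lambda>k. \<xi> k \<omega>) - x)) \<in> borel_measurable M"
      using int[of x, THEN borel_measurable_integrable] by simp
    \<comment> \<open>The constraint holds only almost surely for \<open>\<xi>\<close>, hence so
      does the pointwise Pythagorean identity.\<close>
    show "AE \<omega> in M. cost G N t (\<lambda>k. \<xi> k \<omega>) = cost G N t x + cost G N t ((\<lambda>k. \<xi> k \<omega>) - x)"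
      using strategies_AE_feasible[OF assms(5)]
      by eventually_elim (rule cost_around_stationary_point[OF assms(1,3,4)])
  qed
  also have "\<dots> = cost G N t x + (\<integral>\<omega>. cost G N t ((\<lambda>k. \<xi> k \<omega>) - x) \<partial>M)"
    using int[of x] by (simp add: prob_space)
  finally show ?thesis .
qed

text \<open>The remainder integral of any competitor is nonnegative. The class \<open>S\<close> is
  left open so that the lemma serves deterministic and adapted strategies alike.\<close>

lemma stationary_point_optimal:
  assumes "pos_def_fun (complexify (kernel_ext G))" and "time_grid N t"
    and "feasible N X0 x" "stationary_point G N t x lam"
    and "\<xi> \<in> S" "S \<subseteq> strategies M F N t X0"
    and "\<And>\<omega> k. \<omega> \<in> space M \<Longrightarrow> k \<in> {1..N} \<Longrightarrow> \<xi> k \<omega> = x k"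
  shows "optimal_in S M G N t \<xi>"
  unfolding optimal_in_def
proof (intro conjI ballI)
  fix \<eta> assume "\<eta> \<in> S"
  hence \<eta>: "\<eta> \<in> strategies M F N t X0" using assms(6) by blast
  have "expected_cost M G N t \<eta> = cost G N t x + (\<integral>\<omega>. cost G N t ((\<lambda>k. \<eta> k \<omega>) - x) \<partial>M)"
    by (rule expected_cost_around_stationary_point[OF assms(1-4) \<eta>])
  moreover have "0 \<le> (\<integral>\<omega>. cost G N t ((\<lambda>k. \<eta> k \<omega>) - x) \<partial>M)"
    by (intro integral_nonneg_AE AE_I2 cost_nonneg assms(1))
  moreover have "expected_cost M G N t \<xi> = cost G N t x"
    using assms(7) by (rule expected_cost_det)
  ultimately show "expected_cost M G N t \<xi> \<le> expected_cost M G N t \<eta>" by linarith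
qed (rule assms(5))

lemma det_optimal_iff_lagrange:
  assumes "pos_def_fun (complexify (kernel_ext G))" and "time_grid N t"
    and "\<xi> \<in> det_strategies M F N t X0"
  shows "optimal_in (det_strategies M F N t X0) M G N t \<xi> \<longleftrightarrow> (\<exists>lam. lagrange_eq M G N t \<xi> lam)"
proof -
  obtain x where x: "feasible N X0 x" "\<And>\<omega> k. \<omega> \<in> space M \<Longrightarrow> k \<in> {1..N} \<Longrightarrow> \<xi> k \<omega> = x k"
    using assms(3) by (rule det_strategiesE) blast
  have lag: "lagrange_eq M G N t \<xi> lam \<longleftrightarrow> stationary_point G N t x lam" for lam
    using not_empty x(2) by (rule lagrange_eq_iff)
  show ?thesis
  proof
    assume opt: "optimal_in (det_strategies M F N t X0) M G N t \<xi>"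
    \<comment> \<open>Every feasible family is realised by a constant strategy, so optimality of
      \<open>\<xi>\<close> makes \<open>x\<close> a minimiser over all feasible families.\<close>
    have "cost G N t x \<le> cost G N t y" if "feasible N X0 y" for y
    proof -
      have "expected_cost M G N t \<xi> \<le> expected_cost M G N t (\<lambda>k \<omega>. y k)"
        using opt const_det_strategy[OF that] unfolding optimal_in_def by blast
      moreover have "expected_cost M G N t \<xi> = cost G N t x"
        using x(2) by (rule expected_cost_det)
      moreover have "expected_cost M G N t (\<lambda>k \<omega>. y k) = cost G N t y"
        by (rule expected_cost_det) (rule refl)
      ultimately show ?thesis by simp
    qed
    with minimiser_stationary_point[OF assms(1) x(1)] lag
    show "\<exists>lam. lagrange_eq M G N t \<xi> lam" by blast
  next
    assume "\<exists>lam. lagrange_eq M G N t \<xi> lam"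
    then obtain lam where "stationary_point G N t x lam" using lag by blast
    thus "optimal_in (det_strategies M F N t X0) M G N t \<xi>"
      using stationary_point_optimal[OF assms(1,2) x(1) _ assms(3) det_subset_strategies x(2)]
      by blast
  qed
qed

text \<open>Comparison with the constant strategy \<open>x\<close> forces the remainder integral to
  be zero. Its integrand is nonnegative and so vanishes almost surely, and definiteness on the
  distinct grid times gives equality of the trades.\<close>

lemma optimal_AE_eq_stationary_point:
  assumes "strictly_pos_def_fun (complexify (kernel_ext G))" and "time_grid N t"
    and "feasible N X0 x" "stationary_point G N t x lam"
    and "\<xi> \<in> S" "S \<subseteq> strategies M F N t X0" "(\<lambda>k \<omega>. x k) \<in> S"
    and "optimal_in S M G N t \<xi>"
  shows "AE \<omega> in M. \<forall>k\<in>{1..N}. \<xi> k \<omega> = x k"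
proof -
  have pd: "pos_def_fun (complexify (kernel_ext G))"
    using assms(1) by (simp add: strictly_pos_def_fun_def)
  have \<xi>: "\<xi> \<in> strategies M F N t X0" using assms(5,6) by blast
  have inj: "inj_on t {1..N}"
    using assms(2) strict_mono_on_imp_inj_on by (auto simp: time_grid_def)
  have "expected_cost M G N t \<xi> \<le> cost G N t x"
    using assms(7,8) expected_cost_det[of N "\<lambda>k \<omega>. x k" x, OF refl]
    by (auto simp: optimal_in_def)
  hence "(\<integral>\<omega>. cost G N t ((\<lambda>k. \<xi> k \<omega>) - x) \<partial>M) \<le> 0"
    using expected_cost_around_stationary_point[OF pd assms(2-4) \<xi>] by simp
  moreover have "0 \<le> (\<integral>\<omega>. cost G N t ((\<lambda>k. \<xi> k \<omega>) - x) \<partial>M)"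
    by (intro integral_nonneg_AE AE_I2 cost_nonneg pd)
  ultimately have "(\<integral>\<omega>. cost G N t ((\<lambda>k. \<xi> k \<omega>) - x) \<partial>M) = 0" by simp
  hence "AE \<omega> in M. cost G N t ((\<lambda>k. \<xi> k \<omega>) - x) = 0"
    using integral_nonneg_eq_0_iff_AE[OF integrable_cost_diff[OF assms(2) \<xi>]] cost_nonneg[OF pd]
    by simp
  thus ?thesis
  proof eventually_elim
    case (elim \<omega>)
    hence "kernel_form G N t ((\<lambda>k. \<xi> k \<omega>) - x) ((\<lambda>k. \<xi> k \<omega>) - x) = 0"
      by (simp add: cost_eq_kernel_form)
    from kernel_form_definite[OF assms(1) inj this] show ?case by simp
  qed
qed

text \<open>Both strategies agree almost surely with one constant strategy built from a stationary
  point; it belongs to \<open>S\<close> because \<open>S\<close> contains the deterministic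
  class.\<close>

lemma optimal_unique:
  assumes "strictly_pos_def_fun (complexify (kernel_ext G))" and "time_grid N t"
    and "det_strategies M F N t X0 \<subseteq> S" "S \<subseteq> strategies M F N t X0"
    and "optimal_in S M G N t \<xi>" "optimal_in S M G N t \<eta>"
  shows "same_strategy M N \<xi> \<eta>"
proof -
  have pd: "pos_def_fun (complexify (kernel_ext G))"
    using assms(1) by (simp add: strictly_pos_def_fun_def)
  obtain x lam where x: "feasible N X0 x" "stationary_point G N t x lam"
    using stationary_point_exists[OF pd] assms(2) unfolding time_grid_def by blast
  have "AE \<omega> in M. \<forall>k\<in>{1..N}. \<zeta> k \<omega> = x k" if "optimal_in S M G N t \<zeta>" for \<zeta>
  proof (rule optimal_AE_eq_stationary_point[OF assms(1,2) x _ assms(4) _ that])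
    show "\<zeta> \<in> S" using that by (simp add: optimal_in_def)
    show "(\<lambda>k \<omega>. x k) \<in> S" using const_det_strategy[OF x(1)] assms(3) by blast
  qed
  from this[OF assms(5)] this[OF assms(6)] show ?thesis
    unfolding same_strategy_def by eventually_elim simp
qed

text \<open>The multiplier is read off from the equation at index 1, at any \<open>\<omega>\<close>
  where the two strategies agree.\<close>

lemma lagrange_eq_unique:
  assumes "same_strategy M N \<xi> \<eta>" "1 \<le> N"
    and "lagrange_eq M G N t \<xi> lam" "lagrange_eq M G N t \<eta> lam'"
  shows "lam = lam'"
proof -
  have "AE \<omega> in M. lam = lam'"
    using assms(1)[unfolded same_strategy_def] AE_space
  proof eventually_elim
    case (elim \<omega>)
    have "lam = (\<Sum>l=1..N. kernel_ext G (t 1 - t l) *v \<xi> l \<omega>)"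
      using assms(2,3) elim(2) by (auto simp: lagrange_eq_def)
    also have "\<dots> = (\<Sum>l=1..N. kernel_ext G (t 1 - t l) *v \<eta> l \<omega>)"
      using elim(1) by (intro sum.cong) auto
    also have "\<dots> = lam'"
      using assms(2,4) elim(2) by (auto simp: lagrange_eq_def)
    finally show ?case .
  qed
  thus ?thesis by simp
qed

end

theorem proposition2p7:
  fixes G :: "real \<Rightarrow> real^'k^'k"
    and M :: "'w measure" and F :: "real \<Rightarrow> 'w measure" and T :: real
    and X0 :: "real^'k" and N :: nat and t :: "nat \<Rightarrow> real"
  assumes "decay_kernel G"
    and "pos_def_fun (complexify (kernel_ext G))"
    and "filtered_prob_space M F T"
    and "time_grid N t"
  shows "(\<exists>\<xi>. optimal_in (det_strategies M F N t X0) M G N t \<xi> \<and>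
              optimal_in (strategies M F N t X0) M G N t \<xi>) \<and>
         (\<forall>\<xi>\<in>det_strategies M F N t X0.
            optimal_in (det_strategies M F N t X0) M G N t \<xi> \<longleftrightarrow>
            (\<exists>lam. lagrange_eq M G N t \<xi> lam)) \<and>
         (strictly_pos_def_fun (complexify (kernel_ext G)) \<longrightarrow>
            (\<forall>\<xi> \<eta>. optimal_in (det_strategies M F N t X0) M G N t \<xi> \<longrightarrow>
                   optimal_in (det_strategies M F N t X0) M G N t \<eta> \<longrightarrow>
                   same_strategy M N \<xi> \<eta>) \<and>
            (\<forall>\<xi> \<eta>. optimal_in (strategies M F N t X0) M G N t \<xi> \<longrightarrow>
                   optimal_in (strategies M F N t X0) M G N t \<eta> \<longrightarrow>
                   same_strategy M N \<xi> \<eta>) \<and>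
            (\<exists>!lam. \<exists>\<xi>. optimal_in (det_strategies M F N t X0) M G N t \<xi> \<and>
                        lagrange_eq M G N t \<xi> lam))"
proof -
  interpret filtered_prob_space M F T by (rule assms(3))
  let ?D = "det_strategies M F N t X0" and ?S = "strategies M F N t X0"
  have N: "1 \<le> N" using assms(4) by (simp add: time_grid_def)
  obtain x lam where x: "feasible N X0 x" "stationary_point G N t x lam"
    using stationary_point_exists[OF assms(2) N] by blast
  \<comment> \<open>A single constant strategy is the optimum in both classes.\<close>
  define \<xi>0 :: "nat \<Rightarrow> 'w \<Rightarrow> real^'k" where "\<xi>0 = (\<lambda>k \<omega>. x k)"
  have \<xi>0: "\<xi>0 \<in> ?D" unfolding \<xi>0_def by (rule const_det_strategy[OF x(1)])
  have opt: "optimal_in S M G N t \<xi>0" if "\<xi>0 \<in> S" "S \<subseteq> ?S" for S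
    by (rule stationary_point_optimal[OF assms(2,4) x that]) (simp add: \<xi>0_def)
  have optD: "optimal_in ?D M G N t \<xi>0"
    by (rule opt[OF \<xi>0 det_subset_strategies])
  have optS: "optimal_in ?S M G N t \<xi>0"
    by (rule opt[OF subsetD[OF det_subset_strategies \<xi>0] order_refl])
  have lag: "lagrange_eq M G N t \<xi>0 lam"
    using lagrange_eq_iff[OF not_empty, of N \<xi>0 x] x(2) by (simp add: \<xi>0_def)
  \<comment> \<open>Uniqueness of the multiplier ranges over all optimal deterministic strategies at
    once, since each of them agrees almost surely with \<open>\<xi>0\<close>.\<close>
  have unique: "(\<exists>!lam. \<exists>\<xi>. optimal_in ?D M G N t \<xi> \<and> lagrange_eq M G N t \<xi> lam)"
    if "strictly_pos_def_fun (complexify (kernel_ext G))"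
  proof (rule ex1I)
    show "\<exists>\<xi>. optimal_in ?D M G N t \<xi> \<and> lagrange_eq M G N t \<xi> lam"
      using optD lag by blast
  next
    fix lam' assume "\<exists>\<xi>. optimal_in ?D M G N t \<xi> \<and> lagrange_eq M G N t \<xi> lam'"
    then obtain \<xi> where \<xi>: "optimal_in ?D M G N t \<xi>" "lagrange_eq M G N t \<xi> lam'" by blast
    have "same_strategy M N \<xi> \<xi>0"
      by (rule optimal_unique[OF that assms(4) order_refl det_subset_strategies \<xi>(1) optD])
    thus "lam' = lam" using N \<xi>(2) lag by (rule lagrange_eq_unique)
  qed
  show ?thesis
  proof (intro conjI impI allI ballI)
    show "\<exists>\<xi>. optimal_in ?D M G N t \<xi> \<and> optimal_in ?S M G N t \<xi>"
      using optD optS by blast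
  next
    fix \<xi> assume "\<xi> \<in> ?D"
    thus "optimal_in ?D M G N t \<xi> \<longleftrightarrow> (\<exists>lam. lagrange_eq M G N t \<xi> lam)"
      by (rule det_optimal_iff_lagrange[OF assms(2,4)])
  next
    fix \<xi> \<eta> assume "strictly_pos_def_fun (complexify (kernel_ext G))"
      "optimal_in ?D M G N t \<xi>" "optimal_in ?D M G N t \<eta>"
    thus "same_strategy M N \<xi> \<eta>"
      by (rule optimal_unique[OF _ assms(4) order_refl det_subset_strategies])
  next
    fix \<xi> \<eta> assume "strictly_pos_def_fun (complexify (kernel_ext G))"
      "optimal_in ?S M G N t \<xi>" "optimal_in ?S M G N t \<eta>"
    thus "same_strategy M N \<xi> \<eta>"
      by (rule optimal_unique[OF _ assms(4) det_subset_strategies order_refl])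
  qed (rule unique)
qed

end
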